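(* Let $A,B\in\mathbb{C}^{m\times n}$ with $\operatorname{rank}(A)=r\ge 1$ and $\operatorname{rank}(B)=s\ge 1$, and let $E=B-A$ and $\widetilde{E}=B^{\dagger}-A^{\dagger}$. For parameters $\lambda\in[0,1]$ and $\mu\in[0,1]$ define \[ \Phi(\lambda):=\lambda\big(\|E\|_{F}^{2}-\|A\widetilde{E}B\|_{F}^{2}\big)+(1-\lambda)\big(\|\widetilde{E}\|_{F}^{2}-\|B^{\dagger}EA^{\dagger}\|_{F}^{2}\big), \] \[ \Psi(\mu):=\mu\big(\|E\|_{F}^{2}-\|B\widetilde{E}A\|_{F}^{2}\big)+(1-\mu)\big(\|\widetilde{E}\|_{F}^{2}-\|A^{\dagger}EB^{\dagger}\|_{F}^{2}\big). \] Then, for all $\lambda,\mu\in[0,1]$, \[ \|P_{B}-P_{A}\|_{F}^{2}+\min\bigg\{\frac{I_{A}(\lambda)}{I_{B}(\lambda)},\frac{I_{B}(\mu)}{I_{A}(\mu)}\bigg\}\|P_{B^{\ast}}-P_{A^{\ast}}\|_{F}^{2}\leq\frac{\Phi(\lambda)}{I_{B}(\lambda)}+\frac{\Psi(\mu)}{I_{A}(\mu)}, \] \[ \|P_{B}-P_{A}\|_{F}^{2}+\|P_{B^{\ast}}-P_{A^{\ast}}\|_{F}^{2}\leq\frac{\Phi(\lambda)+\Psi(\mu)}{\min\big\{I_{A}(\lambda),I_{B}(\lambda),I_{A}(\mu),I_{B}(\mu)\big\}}. \] In particular, if $s=r$, then \[ I_{B}(\lambda)\|P_{B}-P_{A}\|_{F}^{2}+I_{A}(\lambda)\|P_{B^{\ast}}-P_{A^{\ast}}\|_{F}^{2}\leq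 2\Phi(\lambda), \] \[ I_{A}(\mu)\|P_{B}-P_{A}\|_{F}^{2}+I_{B}(\mu)\|P_{B^{\ast}}-P_{A^{\ast}}\|_{F}^{2}\leq 2\Psi(\mu). \]
   Context: For a complex matrix $M$: $M^{\ast}$ is the conjugate transpose, $M^{\dagger}$ the Moore--Penrose inverse, $\|M\|_{F}$ the Frobenius norm, $\|M\|_{2}$ the spectral norm, and $P_{M}=MM^{\dagger}$ the orthogonal projection onto the column space of $M$ (so $P_{M^{\ast}}=M^{\dagger}M$). For $M\in\mathbb{C}^{m\times n}\setminus\{0\}$ and $t\in[0,1]$, define \[ I_{M}(t):=\frac{t}{\|M^{\dagger}\|_{2}^{2}}+\frac{1-t}{\|M\|_{2}^{2}}. \] *)

theory Defs
  imports "HOL-Analysis.Analysis"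
begin

definition ctranspose :: "complex ^ 'n ^ 'm \<Rightarrow> complex ^ 'm ^ 'n" where
  "ctranspose M = (\<chi> i j. cnj (M $ j $ i))"

definition frob_norm :: "complex ^ 'n ^ 'm \<Rightarrow> real" where
  "frob_norm M = sqrt (\<Sum>i\<in>UNIV. \<Sum>j\<in>UNIV. (cmod (M $ i $ j))\<^sup>2)"

(* The norm on complex ^ 'n is the Euclidean one, so its operator norm is the spectral norm. *)
definition spectral_norm :: "complex ^ 'n ^ 'm \<Rightarrow> real" where
  "spectral_norm M = onorm ((*v) M)"

text \<open>The four Penrose equations.\<close>

definition is_pinv :: "complex ^ 'n ^ 'm \<Rightarrow> complex ^ 'm ^ 'n \<Rightarrow> bool" where
  "is_pinv M X \<longleftrightarrow>
     M ** X ** M = M \<and> X ** M ** X = X \<and>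
     ctranspose (M ** X) = M ** X \<and> ctranspose (X ** M) = X ** M"

(* Well defined by is_pinv_ex1 below. *)
definition pinv :: "complex ^ 'n ^ 'm \<Rightarrow> complex ^ 'm ^ 'n" where
  "pinv M = (THE X. is_pinv M X)"

definition proj_col :: "complex ^ 'n ^ 'm \<Rightarrow> complex ^ 'm ^ 'm" where
  "proj_col M = M ** pinv M"

(* Meant for nonzero M: division by zero makes the value at M = 0 equal to 0. *)
definition interp :: "complex ^ 'n ^ 'm \<Rightarrow> real \<Rightarrow> real" where
  "interp M t = t / (spectral_norm (pinv M))\<^sup>2 + (1 - t) / (spectral_norm M)\<^sup>2"

definition Phi :: "complex ^ 'n ^ 'm \<Rightarrow> complex ^ 'n ^ 'm \<Rightarrow> real \<Rightarrow> real" where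
  "Phi A B l =
    (let E = B - A; E' = pinv B - pinv A in
      l * ((frob_norm E)\<^sup>2 - (frob_norm (A ** E' ** B))\<^sup>2) +
      (1 - l) * ((frob_norm E')\<^sup>2 - (frob_norm (pinv B ** E ** pinv A))\<^sup>2))"

definition Psi :: "complex ^ 'n ^ 'm \<Rightarrow> complex ^ 'n ^ 'm \<Rightarrow> real \<Rightarrow> real" where
  "Psi A B u =
    (let E = B - A; E' = pinv B - pinv A in
      u * ((frob_norm E)\<^sup>2 - (frob_norm (B ** E' ** A))\<^sup>2) +
      (1 - u) * ((frob_norm E')\<^sup>2 - (frob_norm (pinv A ** E ** pinv B))\<^sup>2))"

subsection \<open>The Moore--Penrose inverse exists and is unique\<close>

lemma ctranspose_mult: "ctranspose (M ** N) = ctranspose N ** ctranspose M"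
  by (simp add: ctranspose_def matrix_matrix_mult_def vec_eq_iff mult.commute)

lemma ctranspose_ctranspose [simp]: "ctranspose (ctranspose M) = M"
  by (simp add: ctranspose_def vec_eq_iff)

lemma inner_ctranspose:
  fixes M :: "complex ^ 'n ^ 'm"
  shows "inner (M *v x) y = inner x (ctranspose M *v y)"
proof -
  have *: "inner a b = Re (a * cnj b)" for a b :: complex
    by (simp add: inner_complex_def)
  have "inner (M *v x) y = (\<Sum>i\<in>UNIV. \<Sum>j\<in>UNIV. Re (M $ i $ j * x $ j * cnj (y $ i)))"
    by (simp only: inner_vec_def * matrix_vector_mult_def vec_lambda_beta sum_distrib_right Re_sum)
  also have "\<dots> = (\<Sum>j\<in>UNIV. \<Sum>i\<in>UNIV. Re (M $ i $ j * x $ j * cnj (y $ i)))"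
    by (rule sum.swap)
  also have "\<dots> = inner x (ctranspose M *v y)"
    by (simp only: inner_vec_def * matrix_vector_mult_def vec_lambda_beta cnj_sum
          sum_distrib_left Re_sum ctranspose_def complex_cnj_mult complex_cnj_cnj mult.assoc mult.left_commute)
  finally show ?thesis .
qed

lemma normal_equation_solvable:
  fixes M :: "complex ^ 'n ^ 'm"
  shows "\<exists>x. ctranspose M *v (M *v x) = ctranspose M *v y"
proof -
  obtain p z where p: "p \<in> span (range ((*v) M))"
    and z: "\<And>w. w \<in> span (range ((*v) M)) \<Longrightarrow> orthogonal z w" and y: "y = p + z"
    using orthogonal_subspace_decomp_exists[of "range ((*v) M)" y] by metis
  have "linear ((*v) M)"
    using bounded_linear.linear matrix_vector_mul_bounded_linear by blast
  then have "subspace (range ((*v) M))"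
    by (simp add: linear_subspace_image)
  then have "p \<in> range ((*v) M)"
    using p by (simp add: span_eq_iff[THEN iffD2])
  then obtain x where x: "p = M *v x" by auto
  have "inner w (ctranspose M *v z) = 0" for w
    using z[OF span_base[OF rangeI[of "(*v) M" w]]]
    by (simp add: orthogonal_def inner_ctranspose[symmetric] inner_commute)
  then have "ctranspose M *v z = 0"
    using inner_eq_zero_iff by blast
  then have "ctranspose M *v (M *v x) = ctranspose M *v y"
    by (simp add: y x matrix_vector_right_distrib)
  then show ?thesis ..
qed

lemma left_semi_inverse_exists:
  fixes M :: "complex ^ 'n ^ 'm"
  obtains Z where "M ** Z ** M = M" "ctranspose (M ** Z) = M ** Z"
proof -
  obtain f where f: "\<And>y. ctranspose M *v (M *v f y) = ctranspose M *v y"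
    using normal_equation_solvable[of M] by metis
  define Z where "Z = (\<chi> i j. f (axis j 1) $ i)"
  have col: "(X ** Y) $ i $ j = (X *v (\<chi> k. Y $ k $ j)) $ i"
    for X :: "complex ^ 'a ^ 'b" and Y :: "complex ^ 'c ^ 'a" and i j
    by (simp add: matrix_matrix_mult_def matrix_vector_mult_def)
  have "(ctranspose M ** M ** Z) $ i $ j = ctranspose M $ i $ j" for i j
  proof -
    have "(\<chi> k. Z $ k $ j) = f (axis j 1)"
      by (simp add: Z_def vec_eq_iff)
    then have "(ctranspose M ** M ** Z) $ i $ j = (ctranspose M *v axis j 1) $ i"
      by (simp add: col f matrix_vector_mul_assoc[symmetric])
    then show ?thesis
      by (simp add: matrix_vector_mult_def axis_def if_distrib cong: if_cong)
  qed
  then have N: "ctranspose M ** (M ** Z) = ctranspose M"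
    by (simp add: vec_eq_iff matrix_mul_assoc)
  then have "ctranspose Z ** ctranspose M ** M = M"
    by (metis ctranspose_ctranspose ctranspose_mult)
  moreover from this have "ctranspose Z ** ctranspose M = M ** Z"
    by (metis N matrix_mul_assoc)
  ultimately show ?thesis
    using that by (metis ctranspose_mult)
qed

lemma is_pinv_exists: "\<exists>X. is_pinv M X"
proof -
  obtain Z where Z: "M ** Z ** M = M" "ctranspose (M ** Z) = M ** Z"
    by (rule left_semi_inverse_exists)
  obtain V where V: "ctranspose M ** V ** ctranspose M = ctranspose M"
    "ctranspose (ctranspose M ** V) = ctranspose M ** V"
    by (rule left_semi_inverse_exists)
  define W where "W = ctranspose V"
  have W: "M ** W ** M = M" "ctranspose (W ** M) = W ** M"
    using V unfolding W_def
    by (metis ctranspose_ctranspose ctranspose_mult matrix_mul_assoc)+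
  have 1: "M ** (W ** M ** Z) = M ** Z" and 2: "W ** M ** Z ** M = W ** M"
    using Z(1) W(1) by (metis matrix_mul_assoc)+
  have "is_pinv M (W ** M ** Z)"
    unfolding is_pinv_def 1 2 using Z W by (metis matrix_mul_assoc)
  then show ?thesis ..
qed

lemma is_pinv_unique:
  assumes X: "is_pinv M X" and Y: "is_pinv M Y"
  shows "X = Y"
proof -
  have "M ** X = ctranspose (M ** Y ** M ** X)"
    using X Y by (simp add: is_pinv_def)
  also have "\<dots> = ctranspose (M ** X) ** ctranspose (M ** Y)"
    by (simp add: ctranspose_mult matrix_mul_assoc)
  also have "\<dots> = M ** X ** M ** Y"
    using X Y by (simp add: is_pinv_def matrix_mul_assoc)
  also have "\<dots> = M ** Y"
    using X by (simp add: is_pinv_def)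
  finally have 1: "M ** X = M ** Y" .
  have "X ** M = ctranspose (X ** (M ** Y ** M))"
    using X Y by (simp add: is_pinv_def)
  also have "\<dots> = ctranspose (Y ** M) ** ctranspose (X ** M)"
    by (simp add: ctranspose_mult matrix_mul_assoc)
  also have "\<dots> = Y ** M ** (X ** M)"
    using X Y by (simp add: is_pinv_def)
  also have "\<dots> = Y ** (M ** X ** M)"
    by (simp add: matrix_mul_assoc)
  also have "\<dots> = Y ** M"
    using X by (simp add: is_pinv_def)
  finally have 2: "X ** M = Y ** M" .
  have "X = X ** M ** X" using X by (simp add: is_pinv_def)
  also have "\<dots> = Y ** M ** X" by (simp add: 2)
  also have "\<dots> = Y ** M ** Y" using 1 by (simp add: matrix_mul_assoc[symmetric])
  also have "\<dots> = Y" using Y by (simp add: is_pinv_def)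
  finally show ?thesis .
qed

lemma is_pinv_ex1: "\<exists>!X. is_pinv M X"
  using is_pinv_exists is_pinv_unique by blast

lemma is_pinv_pinv: "is_pinv M (pinv M)"
  unfolding pinv_def by (rule theI'[OF is_pinv_ex1])

end

theory Submission
  imports Defs
begin

text \<open>
  Write \<open>P\<close>, \<open>Q\<close> for the projections onto the column spaces of \<open>A\<close>, \<open>B\<close> and \<open>R\<close>, \<open>S\<close> for those onto
  their row spaces. Since \<open>A E' B = AS - PB = - P E S\<close>, Pythagoras splits \<open>\<parallel>E\<parallel>\<^sup>2 - \<parallel>A E' B\<parallel>\<^sup>2\<close> into
  \<open>\<parallel>(1 - P)B\<parallel>\<^sup>2 + \<parallel>A(1 - S)\<parallel>\<^sup>2\<close>, and likewise for the pseudoinverses. Multiplying by \<open>B\<^sup>\<dagger>\<close>, \<open>A\<^sup>\<dagger>\<close>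
  (or \<open>B\<close>, \<open>A\<close>) costs at most a factor of their spectral norms, which gives
  \<open>\<Phi> \<ge> I\<^sub>B \<parallel>(1 - P)Q\<parallel>\<^sup>2 + I\<^sub>A \<parallel>R(1 - S)\<parallel>\<^sup>2\<close>; \<open>\<Psi>\<close> is \<open>\<Phi>\<close> with \<open>A\<close>, \<open>B\<close> interchanged. Finally
  \<open>\<parallel>Q - P\<parallel>\<^sup>2 = \<parallel>(1 - P)Q\<parallel>\<^sup>2 + \<parallel>(1 - Q)P\<parallel>\<^sup>2\<close>, and the two summands agree when the ranks do, because
  the squared Frobenius norm of an orthogonal projection is its trace.
\<close>

section \<open>The Frobenius norm and its real inner product\<close>

lemma frob_norm_eq_norm: "frob_norm M = norm M"
  by (simp add: frob_norm_def norm_vec_def L2_set_def sum_nonneg)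

lemma matrix_diff_ldistrib:
  fixes A :: "'a::ring_1 ^ 'n ^ 'm"
  shows "A ** (B - C) = A ** B - A ** C"
  by (simp add: matrix_matrix_mult_def vec_eq_iff right_diff_distrib sum_subtractf)

lemma matrix_diff_rdistrib:
  fixes C :: "'a::ring_1 ^ 'n ^ 'm"
  shows "(A - B) ** C = A ** C - B ** C"
  by (simp add: matrix_matrix_mult_def vec_eq_iff left_diff_distrib sum_subtractf)

lemma ctranspose_diff: "ctranspose (M - N) = ctranspose M - ctranspose N"
  by (simp add: ctranspose_def vec_eq_iff)

lemma ctranspose_mat_1 [simp]: "ctranspose (mat 1) = mat 1"
  by (auto simp: ctranspose_def mat_def vec_eq_iff)

lemma norm_ctranspose: "norm (ctranspose M) = norm M"
  unfolding frob_norm_eq_norm[symmetric] frob_norm_def ctranspose_def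
  by (subst sum.swap) simp

lemma inner_eq_sum_columns:
  fixes X Y :: "complex ^ 'n ^ 'm"
  shows "inner X Y = (\<Sum>j\<in>UNIV. inner (column j X) (column j Y))"
  unfolding inner_vec_def column_def by (subst sum.swap) simp

lemma norm_sq_eq_sum_columns:
  fixes X :: "complex ^ 'n ^ 'm"
  shows "(norm X)\<^sup>2 = (\<Sum>j\<in>UNIV. (norm (column j X))\<^sup>2)"
  by (simp add: power2_norm_eq_inner inner_eq_sum_columns)

lemma column_matrix_mult: "column j (M ** X) = M *v column j X"
  by (simp add: column_def matrix_matrix_mult_def matrix_vector_mult_def vec_eq_iff)

text \<open>Multiplication by \<open>M\<close> acts column by column, so the vector adjoint identity
  carries over to the inner product behind the Frobenius norm.\<close>

lemma inner_matrix_mult_left: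
  fixes M :: "complex ^ 'n ^ 'm"
  shows "inner (M ** X) Y = inner X (ctranspose M ** Y)"
  by (simp add: inner_eq_sum_columns column_matrix_mult inner_ctranspose)

section \<open>The spectral norm as a bound on matrix products\<close>

lemma norm_matrix_vector_le: "norm (M *v x) \<le> spectral_norm M * norm x"
  unfolding spectral_norm_def by (rule onorm) (rule matrix_vector_mul_bounded_linear)

lemma spectral_norm_nonneg: "0 \<le> spectral_norm M"
  unfolding spectral_norm_def by (rule onorm_pos_le) (rule matrix_vector_mul_bounded_linear)

lemma spectral_norm_pos:
  assumes "M \<noteq> 0"
  shows "0 < spectral_norm M"
proof -
  have "\<exists>x. M *v x \<noteq> 0 *v x"
    using assms matrix_eq by blast
  then show ?thesis
    unfolding spectral_norm_def
    by (subst onorm_pos_lt) (auto intro: matrix_vector_mul_bounded_linear)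
qed

text \<open>For \<open>z = ctranspose M *v y\<close>, moving \<open>M\<close> across the inner
  product and Cauchy-Schwarz bound the square of \<open>norm z\<close> by
  \<open>norm y * spectral_norm M * norm z\<close>; then one factor \<open>norm z\<close>
  cancels.\<close>

lemma spectral_norm_ctranspose_le: "spectral_norm (ctranspose M) \<le> spectral_norm M"
proof -
  have "norm (ctranspose M *v y) \<le> spectral_norm M * norm y" for y
  proof -
    let ?z = "ctranspose M *v y"
    have "norm ?z * norm ?z = inner y (M *v ?z)"
      using inner_ctranspose[of M ?z y] by (simp add: inner_commute flip: power2_eq_square power2_norm_eq_inner)
    also have "\<dots> \<le> norm y * norm (M *v ?z)"
      by (rule norm_cauchy_schwarz)
    also have "\<dots> \<le> norm y * (spectral_norm M * norm ?z)"
      by (intro mult_left_mono norm_matrix_vector_le) simp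
    finally have *: "norm ?z * norm ?z \<le> (spectral_norm M * norm y) * norm ?z"
      by (simp add: mult_ac)
    show ?thesis
    proof (cases "norm ?z = 0")
      case True
      then show ?thesis
        by (simp add: spectral_norm_nonneg)
    next
      case False
      then show ?thesis
        using * by (simp add: mult_le_cancel_right)
    qed
  qed
  then show ?thesis
    unfolding spectral_norm_def[of "ctranspose M"] by (rule onorm_le)
qed

lemma norm_matrix_mult_le_left:
  fixes M :: "complex ^ 'n ^ 'm"
  shows "norm (M ** X) \<le> spectral_norm M * norm X"
proof (rule power2_le_imp_le)
  have "(norm (M ** X))\<^sup>2 \<le> (\<Sum>j\<in>UNIV. (spectral_norm M * norm (column j X))\<^sup>2)"
    unfolding norm_sq_eq_sum_columns column_matrix_mult
    by (intro sum_mono power_mono norm_matrix_vector_le) simp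
  also have "\<dots> = (spectral_norm M * norm X)\<^sup>2"
    by (simp add: power_mult_distrib norm_sq_eq_sum_columns sum_distrib_left)
  finally show "(norm (M ** X))\<^sup>2 \<le> (spectral_norm M * norm X)\<^sup>2" .
qed (simp add: spectral_norm_nonneg)

text \<open>Taking adjoints turns right multiplication into left multiplication.\<close>

lemma norm_matrix_mult_le_right:
  fixes M :: "complex ^ 'n ^ 'm"
  shows "norm (X ** M) \<le> spectral_norm M * norm X"
proof -
  have "norm (X ** M) \<le> spectral_norm (ctranspose M) * norm X"
    using norm_matrix_mult_le_left[of "ctranspose M" "ctranspose X"]
    by (simp add: norm_ctranspose flip: ctranspose_mult)
  also have "\<dots> \<le> spectral_norm M * norm X"
    by (intro mult_right_mono spectral_norm_ctranspose_le) simp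
  finally show ?thesis .
qed

section \<open>Orthogonal projections and Pythagoras\<close>

definition orth_proj :: "complex ^ 'n ^ 'n \<Rightarrow> bool" where
  "orth_proj P \<longleftrightarrow> P ** P = P \<and> ctranspose P = P"

lemma norm_hermitian_mult:
  assumes "ctranspose P = P"
  shows "norm (P ** X) = norm (ctranspose X ** P)"
  using norm_ctranspose[of "P ** X"] by (simp add: ctranspose_mult assms)

lemma orth_proj_hermitian:
  assumes "orth_proj P"
  shows "ctranspose P = P" "ctranspose (mat 1 - P) = mat 1 - P"
  using assms by (simp_all add: orth_proj_def ctranspose_diff)

text \<open>The two parts are orthogonal: moving the Hermitian \<open>P\<close> across the inner
  product produces \<open>P ** (mat 1 - P) = 0\<close>.\<close>

lemma norm_sq_split_left:
  assumes "orth_proj P"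
  shows "(norm X)\<^sup>2 = (norm (P ** X))\<^sup>2 + (norm ((mat 1 - P) ** X))\<^sup>2"
proof -
  have "P ** ((mat 1 - P) ** X) = 0"
    using assms by (simp add: orth_proj_def matrix_mul_assoc matrix_diff_ldistrib)
  then have "orthogonal (P ** X) ((mat 1 - P) ** X)"
    using assms by (simp add: orthogonal_def inner_matrix_mult_left orth_proj_def)
  then have "(norm (P ** X + (mat 1 - P) ** X))\<^sup>2 = (norm (P ** X))\<^sup>2 + (norm ((mat 1 - P) ** X))\<^sup>2"
    by (rule norm_add_Pythagorean)
  then show ?thesis
    by (simp add: matrix_diff_rdistrib)
qed

lemma norm_sq_split_right:
  assumes "orth_proj P"
  shows "(norm X)\<^sup>2 = (norm (X ** P))\<^sup>2 + (norm (X ** (mat 1 - P)))\<^sup>2"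
  using norm_sq_split_left[OF assms, of "ctranspose X"]
  by (simp add: norm_ctranspose norm_hermitian_mult orth_proj_hermitian[OF assms])

lemma norm_sq_orth_proj:
  assumes "orth_proj P"
  shows "(norm P)\<^sup>2 = Re (trace P)"
proof -
  have "(norm P)\<^sup>2 = inner (mat 1) P"
    using assms inner_matrix_mult_left[of P "mat 1" P]
    by (simp add: power2_norm_eq_inner orth_proj_def)
  also have "\<dots> = Re (trace P)"
  proof -
    have "inner (mat 1 $ i $ j) (P $ i $ j) = (if i = j then Re (P $ i $ i) else 0)" for i j
      by (simp add: mat_def inner_complex_def)
    then show ?thesis
      by (simp add: inner_vec_def trace_def)
  qed
  finally show ?thesis .
qed

lemma norm_complement_mult_commute:
  assumes "orth_proj P" "orth_proj Q"
  shows "norm ((mat 1 - P) ** Q) = norm (Q ** (mat 1 - P))"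
  using norm_hermitian_mult[of "mat 1 - P" Q] by (simp add: orth_proj_hermitian assms)

text \<open>Splitting \<open>Q - P\<close> along \<open>P\<close> leaves
  \<open>(mat 1 - P) ** Q\<close> and \<open>- (P ** (mat 1 - Q))\<close>; the latter has the norm
  of its adjoint.\<close>

lemma norm_sq_diff_orth_proj:
  assumes P: "orth_proj P" and Q: "orth_proj Q"
  shows "(norm (Q - P))\<^sup>2 = (norm ((mat 1 - P) ** Q))\<^sup>2 + (norm ((mat 1 - Q) ** P))\<^sup>2"
proof -
  have "(mat 1 - P) ** (Q - P) = (mat 1 - P) ** Q" "P ** (Q - P) = - (P ** (mat 1 - Q))"
    using P by (simp_all add: orth_proj_def matrix_diff_ldistrib matrix_diff_rdistrib)
  then show ?thesis
    using norm_sq_split_left[OF P, of "Q - P"] norm_complement_mult_commute[OF Q P] by simp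
qed

text \<open>By Pythagoras the squared norms are the real traces of \<open>Q\<close> and
  \<open>P\<close> minus those of \<open>P ** Q\<close> and \<open>Q ** P\<close>, which are adjoint
  to each other and so have equal norm.\<close>

lemma norm_complement_eq_if_trace_eq:
  assumes P: "orth_proj P" and Q: "orth_proj Q" and "trace P = trace Q"
  shows "norm ((mat 1 - P) ** Q) = norm ((mat 1 - Q) ** P)"
proof -
  have "norm (P ** Q) = norm (Q ** P)"
    using norm_hermitian_mult[of P Q] by (simp add: orth_proj_hermitian P Q)
  then have "(norm ((mat 1 - P) ** Q))\<^sup>2 = (norm ((mat 1 - Q) ** P))\<^sup>2"
    using norm_sq_split_left[OF P, of Q] norm_sq_split_left[OF Q, of P] assms(3)
    by (simp add: norm_sq_orth_proj P Q)
  then show ?thesis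
    by (simp add: power2_eq_iff_nonneg)
qed

section \<open>Rank, range and the trace of idempotents\<close>

lemma span_columns_eq_range:
  fixes M :: "'a::field ^ 'n ^ 'm"
  shows "vec.span (columns M) = range ((*v) M)"
proof
  have "columns M \<subseteq> range ((*v) M)"
    by (force simp: columns_def column_def matrix_vector_mult_def vec_eq_iff image_iff axis_def
        if_distrib cong: if_cong intro: exI[of _ "axis _ 1"])
  moreover have "vec.subspace (range ((*v) M))"
    by (rule vec.subspace_image[OF vec.subspace_UNIV])
  ultimately show "vec.span (columns M) \<subseteq> range ((*v) M)"
    by (rule vec.span_minimal)
qed (auto simp: matrix_vector_mult_in_columnspace_gen)

text \<open>\<open>rank\<close> is defined through the rows, hence the transpose.\<close>

lemma rank_eq_dim_range_transpose:
  fixes M :: "'a::field ^ 'n ^ 'm"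
  shows "rank M = vec.dim (range ((*v) (transpose M)))"
  by (metis row_rank_def_gen columns_transpose span_columns_eq_range vec.dim_span)

text \<open>A linear isomorphism \<open>f\<close> between the ranges gives \<open>L = (f K) (f\<^sup>-\<^sup>1 L)\<close> and \<open>K = (f\<^sup>-\<^sup>1 L) (f K)\<close>.\<close>

lemma trace_idempotent_eq:
  fixes K L :: "'a::field ^ 'n ^ 'n"
  assumes K: "K ** K = K" and L: "L ** L = L"
    and dim: "vec.dim (range ((*v) K)) = vec.dim (range ((*v) L))"
  shows "trace K = trace L"
proof -
  let ?V = "range ((*v) K)" and ?W = "range ((*v) L)"
  have sub: "vec.subspace ?V" "vec.subspace ?W"
    by (rule vec.subspace_image[OF vec.subspace_UNIV])+
  obtain f where f: "Vector_Spaces.linear (*s) (*s) f" "f ` ?V = ?W" "inj_on f ?V"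
    using vec.subspace_isomorphism[OF sub dim] by blast
  obtain g where g: "range g \<subseteq> ?V" "Vector_Spaces.linear (*s) (*s) g" "\<forall>v\<in>?V. g (f v) = v"
    using vec.linear_exists_left_inverse_on[OF f(1) sub(1) f(3)] by blast
  have Kid: "K *v v = v" if "v \<in> ?V" for v
    using that K by (auto simp: matrix_vector_mul_assoc)
  have Lid: "L *v w = w" if "w \<in> ?W" for w
    using that L by (auto simp: matrix_vector_mul_assoc)
  have fg: "f (g w) = w" if "w \<in> ?W" for w
  proof -
    have "w \<in> f ` ?V"
      unfolding f(2) by (rule that)
    then obtain v where v: "w = f v" "v \<in> ?V"
      by (rule imageE)
    show ?thesis
      unfolding v(1) bspec[OF g(3) v(2)] by (rule refl)
  qed
  define U where "U = matrix f ** K"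
  define Z where "Z = matrix g ** L"
  have U: "U *v x = f (K *v x)" and Z: "Z *v x = g (L *v x)" for x
    by (simp_all add: U_def Z_def matrix_works[OF f(1)] matrix_works[OF g(2)]
        flip: matrix_vector_mul_assoc)
  have "U ** Z = L"
    unfolding matrix_eq
  proof
    fix x
    have "K *v g (L *v x) = g (L *v x)"
      by (rule Kid) (use g(1) in blast)
    then show "U ** Z *v x = L *v x"
      by (simp add: U Z fg flip: matrix_vector_mul_assoc)
  qed
  moreover have "Z ** U = K"
    unfolding matrix_eq
  proof
    fix x
    have "L *v f (K *v x) = f (K *v x)"
      by (rule Lid) (use f(2) in blast)
    then show "Z ** U *v x = K *v x"
      using g(3) by (simp add: U Z flip: matrix_vector_mul_assoc)
  qed
  ultimately show ?thesis
    by (metis trace_mul_sym)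
qed

section \<open>Projections built from the Moore-Penrose inverse\<close>

lemma pinv_eqs:
  shows "M ** pinv M ** M = M" "pinv M ** M ** pinv M = pinv M"
    "orth_proj (M ** pinv M)" "orth_proj (pinv M ** M)"
  using is_pinv_pinv[of M] by (simp_all add: is_pinv_def orth_proj_def matrix_mul_assoc)

lemma pinv_eqs_assoc:
  "M ** (pinv M ** M) = M" "pinv M ** (M ** pinv M) = pinv M"
  by (simp_all add: matrix_mul_assoc pinv_eqs)

lemma pinv_nonzero:
  assumes "M \<noteq> 0"
  shows "pinv M \<noteq> 0"
  using assms pinv_eqs(1)[of M] by auto

text \<open>Adjoints interchange the projections \<open>M ** pinv M\<close> and
  \<open>pinv M ** M\<close>, so the Penrose equations persist and uniqueness applies.\<close>

lemma pinv_ctranspose: "pinv (ctranspose M) = ctranspose (pinv M)"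
proof (rule is_pinv_unique[OF is_pinv_pinv])
  have "ctranspose M ** ctranspose (pinv M) ** ctranspose M = ctranspose (M ** pinv M ** M)"
    "ctranspose (pinv M) ** ctranspose M ** ctranspose (pinv M)
      = ctranspose (pinv M ** M ** pinv M)"
    by (simp_all add: ctranspose_mult matrix_mul_assoc)
  moreover have "ctranspose M ** ctranspose (pinv M) = pinv M ** M"
    "ctranspose (pinv M) ** ctranspose M = M ** pinv M"
    using pinv_eqs(3,4)[of M] by (simp_all add: orth_proj_def flip: ctranspose_mult)
  ultimately show "is_pinv (ctranspose M) (ctranspose (pinv M))"
    using pinv_eqs[of M] by (simp add: is_pinv_def orth_proj_def)
qed

lemma proj_col_ctranspose: "proj_col (ctranspose M) = pinv M ** M"
  using pinv_eqs(4)[of M]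
  by (simp add: proj_col_def pinv_ctranspose orth_proj_def flip: ctranspose_mult)

text \<open>The transpose of \<open>pinv M ** M\<close> is an idempotent with the range of
  \<open>transpose M\<close>, whose dimension is the rank. Transposing does not change the
  trace.\<close>

lemma trace_pinv_mult_eq:
  fixes A B :: "complex ^ 'n ^ 'm"
  assumes "rank A = rank B"
  shows "trace (pinv A ** A) = trace (pinv B ** B)"
proof -
  have range: "range ((*v) (transpose (pinv M ** M))) = range ((*v) (transpose M))"
    for M :: "complex ^ 'n ^ 'm"
  proof -
    have "transpose (pinv M ** M) ** transpose M = transpose M"
      "transpose (pinv M ** M) = transpose M ** transpose (pinv M)"
      by (simp_all add: matrix_mul_assoc pinv_eqs flip: matrix_transpose_mul)
    then show ?thesis
      by (smt (verit, best) image_subset_iff matrix_vector_mul_assoc range_eqI subset_antisym)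
  qed
  have idem: "transpose (pinv M ** M) ** transpose (pinv M ** M) = transpose (pinv M ** M)"
    for M :: "complex ^ 'n ^ 'm"
    using pinv_eqs(4)[of M] by (simp add: orth_proj_def flip: matrix_transpose_mul)
  have "trace (transpose (pinv A ** A)) = trace (transpose (pinv B ** B))"
    by (rule trace_idempotent_eq[OF idem idem])
      (simp only: range assms flip: rank_eq_dim_range_transpose)
  then show ?thesis
    by (simp add: trace_def transpose_def)
qed

lemma norm_complement_proj_eq_if_rank_eq:
  fixes A B :: "complex ^ 'n ^ 'm"
  assumes "rank A = rank B"
  shows "norm ((mat 1 - A ** pinv A) ** (B ** pinv B)) = norm ((mat 1 - B ** pinv B) ** (A ** pinv A))"
    and "norm ((mat 1 - pinv B ** B) ** (pinv A ** A)) = norm ((mat 1 - pinv A ** A) ** (pinv B ** B))"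
proof -
  note row = trace_pinv_mult_eq[OF assms]
  \<comment> \<open>Cyclicity of the trace carries the equality from the row spaces to the column
    spaces.\<close>
  have col: "trace (A ** pinv A) = trace (B ** pinv B)"
    using row by (simp only: trace_mul_sym[of _ "pinv _"])
  show "norm ((mat 1 - A ** pinv A) ** (B ** pinv B)) = norm ((mat 1 - B ** pinv B) ** (A ** pinv A))"
    by (intro norm_complement_eq_if_trace_eq pinv_eqs col)
  show "norm ((mat 1 - pinv B ** B) ** (pinv A ** A)) = norm ((mat 1 - pinv A ** A) ** (pinv B ** B))"
    by (intro norm_complement_eq_if_trace_eq pinv_eqs row[symmetric])
qed

section \<open>The weights \<open>interp\<close> and the lower bound for \<open>Phi\<close>\<close>

lemma interp_pos:
  assumes "M \<noteq> 0" "t \<in> {0..1}"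
  shows "0 < interp M t"
proof -
  have *: "0 < spectral_norm M" "0 < spectral_norm (pinv M)"
    using assms(1) by (simp_all add: spectral_norm_pos pinv_nonzero)
  show ?thesis
  proof (cases "t = 0")
    case True
    then show ?thesis
      using * by (simp add: interp_def)
  next
    case False
    then show ?thesis
      using * assms(2) unfolding interp_def by (intro add_pos_nonneg) simp_all
  qed
qed

text \<open>Pythagoras is applied twice: \<open>P\<close> from the left, where
  \<open>mat 1 - P\<close> kills \<open>A\<close>, then \<open>S\<close> from the right, where
  \<open>mat 1 - S\<close> is killed by \<open>B\<close>. Abstract projections let it serve both
  \<open>E\<close> and the difference of pseudoinverses.\<close>

lemma norm_sq_diff_split:
  fixes A B :: "complex ^ 'n ^ 'm"
  assumes P: "orth_proj P" "P ** A = A" and S: "orth_proj S" "B ** S = B"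
  shows "(norm (B - A))\<^sup>2 - (norm (P ** (B - A) ** S))\<^sup>2
    = (norm ((mat 1 - P) ** B))\<^sup>2 + (norm (A ** (mat 1 - S)))\<^sup>2"
proof -
  have "(mat 1 - P) ** (B - A) = (mat 1 - P) ** B"
    by (simp add: matrix_diff_ldistrib matrix_diff_rdistrib P)
  moreover have "P ** (B - A) ** (mat 1 - S) = - (A ** (mat 1 - S))"
    by (simp add: matrix_diff_ldistrib matrix_diff_rdistrib P S flip: matrix_mul_assoc)
  ultimately show ?thesis
    using norm_sq_split_left[OF P(1), of "B - A"] norm_sq_split_right[OF S(1), of "P ** (B - A)"]
    by simp
qed

lemma frob_diff_split:
  fixes A B :: "complex ^ 'n ^ 'm"
  shows "(norm (B - A))\<^sup>2 - (norm (A ** (pinv B - pinv A) ** B))\<^sup>2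
    = (norm ((mat 1 - A ** pinv A) ** B))\<^sup>2 + (norm (A ** (mat 1 - pinv B ** B)))\<^sup>2"
proof -
  let ?P = "A ** pinv A" and ?S = "pinv B ** B"
  have "?P ** (B - A) ** ?S = - (A ** (pinv B - pinv A) ** B)"
    by (simp add: matrix_diff_ldistrib matrix_diff_rdistrib matrix_mul_assoc pinv_eqs)
       (simp add: pinv_eqs_assoc flip: matrix_mul_assoc)
  then show ?thesis
    using norm_sq_diff_split[of ?P A ?S B] by (simp add: pinv_eqs matrix_mul_assoc)
qed

lemma pinv_diff_split:
  fixes A B :: "complex ^ 'n ^ 'm"
  shows "(norm (pinv B - pinv A))\<^sup>2 - (norm (pinv B ** (B - A) ** pinv A))\<^sup>2
    = (norm (pinv B ** (mat 1 - A ** pinv A)))\<^sup>2 + (norm ((mat 1 - pinv B ** B) ** pinv A))\<^sup>2"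
proof -
  let ?P = "A ** pinv A" and ?S = "pinv B ** B"
  have "?S ** (pinv A - pinv B) ** ?P = pinv B ** (B - A) ** pinv A"
    by (simp add: matrix_diff_ldistrib matrix_diff_rdistrib matrix_mul_assoc pinv_eqs)
       (simp add: pinv_eqs_assoc flip: matrix_mul_assoc)
  \<comment> \<open>The projections trade sides here: \<open>?S\<close> fixes \<open>pinv B\<close>
    from the left and \<open>?P\<close> fixes \<open>pinv A\<close> from the right.\<close>
  then show ?thesis
    using norm_sq_diff_split[of ?S "pinv B" ?P "pinv A"]
    by (simp add: pinv_eqs matrix_mul_assoc norm_minus_commute)
qed

lemma square_bound:
  assumes "x \<le> k * y" "0 < k" "0 \<le> (x::real)"
  shows "x\<^sup>2 / k\<^sup>2 \<le> y\<^sup>2"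
proof -
  have "x\<^sup>2 \<le> (k * y)\<^sup>2"
    using assms by (intro power_mono)
  then show ?thesis
    using assms by (simp add: power_mult_distrib divide_le_eq mult.commute)
qed

lemma Phi_ge:
  fixes A B :: "complex ^ 'n ^ 'm"
  assumes "A \<noteq> 0" "B \<noteq> 0" "l \<in> {0..1}"
  shows "interp B l * (norm ((mat 1 - A ** pinv A) ** (B ** pinv B)))\<^sup>2
    + interp A l * (norm ((mat 1 - pinv B ** B) ** (pinv A ** A)))\<^sup>2 \<le> Phi A B l"
proof -
  let ?P = "A ** pinv A" and ?Q = "B ** pinv B" and ?R = "pinv A ** A" and ?S = "pinv B ** B"
  let ?a = "(norm ((mat 1 - ?P) ** ?Q))\<^sup>2" and ?b = "(norm ((mat 1 - ?S) ** ?R))\<^sup>2"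
  note pos = spectral_norm_pos[OF assms(1)] spectral_norm_pos[OF assms(2)]
    spectral_norm_pos[OF pinv_nonzero[OF assms(1)]] spectral_norm_pos[OF pinv_nonzero[OF assms(2)]]
  \<comment> \<open>Multiplying from the left yields the factors in the opposite order; passing to
    adjoints restores it.\<close>
  have PQ: "norm ((mat 1 - ?P) ** ?Q) = norm (?Q ** (mat 1 - ?P))"
    and RS: "norm ((mat 1 - ?S) ** ?R) = norm (?R ** (mat 1 - ?S))"
    by (intro norm_complement_mult_commute pinv_eqs)+
  \<comment> \<open>The multipliers in the four bounds are \<open>pinv B\<close>,
    \<open>pinv A\<close>, \<open>B\<close> and \<open>A\<close>, in this order.\<close>
  have 1: "?a / (spectral_norm (pinv B))\<^sup>2 \<le> (norm ((mat 1 - ?P) ** B))\<^sup>2"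
    by (intro square_bound pos)
      (use norm_matrix_mult_le_right[of "(mat 1 - ?P) ** B" "pinv B"] in
        \<open>simp_all add: matrix_mul_assoc\<close>)
  have 2: "?b / (spectral_norm (pinv A))\<^sup>2 \<le> (norm (A ** (mat 1 - ?S)))\<^sup>2"
    unfolding RS
    by (intro square_bound pos)
      (use norm_matrix_mult_le_left[of "pinv A" "A ** (mat 1 - ?S)"] in
        \<open>simp_all add: matrix_mul_assoc\<close>)
  have 3: "?a / (spectral_norm B)\<^sup>2 \<le> (norm (pinv B ** (mat 1 - ?P)))\<^sup>2"
    unfolding PQ
    by (intro square_bound pos)
      (use norm_matrix_mult_le_left[of B "pinv B ** (mat 1 - ?P)"] in
        \<open>simp_all add: matrix_mul_assoc\<close>)
  have 4: "?b / (spectral_norm A)\<^sup>2 \<le> (norm ((mat 1 - ?S) ** pinv A))\<^sup>2"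
    by (intro square_bound pos)
      (use norm_matrix_mult_le_right[of "(mat 1 - ?S) ** pinv A" A] in
        \<open>simp_all add: matrix_mul_assoc\<close>)
  have "interp B l * ?a + interp A l * ?b
    = l * (?a / (spectral_norm (pinv B))\<^sup>2 + ?b / (spectral_norm (pinv A))\<^sup>2)
      + (1 - l) * (?a / (spectral_norm B)\<^sup>2 + ?b / (spectral_norm A)\<^sup>2)"
    by (simp add: interp_def algebra_simps)
  also have "\<dots> \<le> Phi A B l"
    unfolding Phi_def Let_def frob_norm_eq_norm frob_diff_split pinv_diff_split
    using assms(3) by (intro add_mono mult_left_mono 1 2 3 4) auto
  finally show ?thesis .
qed

section \<open>Symmetry between \<open>Phi\<close> and \<open>Psi\<close>, and combining their
  bounds\<close>

lemma norm_mult_diff_commute: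
  fixes X :: "complex ^ 'c ^ 'd" and Y :: "complex ^ 'a ^ 'b"
  shows "norm (X ** (M - N) ** Y) = norm (X ** (N - M) ** Y)"
  by (simp add: matrix_diff_ldistrib matrix_diff_rdistrib norm_minus_commute)

text \<open>Interchanging \<open>A\<close> and \<open>B\<close> only negates both differences, which
  norms do not see.\<close>

lemma Psi_eq_Phi: "Psi A B u = Phi B A u"
  unfolding Psi_def Phi_def Let_def frob_norm_eq_norm
  by (simp only: norm_mult_diff_commute[of B "pinv B"] norm_mult_diff_commute[of "pinv A" B]
      norm_minus_commute[of B] norm_minus_commute[of "pinv B"])

text \<open>Dividing each bound by its leading weight gives \<open>a\<close> and \<open>c\<close>
  coefficient 1; the remaining ratios are at least their minimum.\<close>

lemma weighted_bound:
  fixes a b c d :: real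
  assumes Phi: "p * a + q * b \<le> F" and Psi: "v * c + w * d \<le> G"
    and pos: "0 < p" "0 < v" and nonneg: "0 \<le> b" "0 \<le> d"
  shows "a + c + min (q / p) (w / v) * (d + b) \<le> F / p + G / v"
proof -
  let ?m = "min (q / p) (w / v)"
  have "?m * b \<le> q / p * b" "?m * d \<le> w / v * d"
    using nonneg by (intro mult_right_mono; simp)+
  moreover have "a + q / p * b \<le> F / p"
    using divide_right_mono[OF Phi, of p] pos by (simp add: add_divide_distrib)
  moreover have "c + w / v * d \<le> G / v"
    using divide_right_mono[OF Psi, of v] pos by (simp add: add_divide_distrib)
  ultimately show ?thesis
    by (simp add: distrib_left)
qed

lemma uniform_bound:
  fixes a b c d :: real
  assumes "p * a + q * b \<le> F" "v * c + w * d \<le> G"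
    and pos: "0 < p" "0 < q" "0 < v" "0 < w"
    and nonneg: "0 \<le> a" "0 \<le> b" "0 \<le> c" "0 \<le> d"
  shows "a + c + (d + b) \<le> (F + G) / Min {q, p, v, w}"
proof -
  let ?M = "Min {q, p, v, w}"
  have "?M * a \<le> p * a" "?M * b \<le> q * b" "?M * c \<le> v * c" "?M * d \<le> w * d"
    using nonneg by (intro mult_right_mono; simp)+
  with assms(1,2) have "(a + c + (d + b)) * ?M \<le> F + G"
    by (simp only: distrib_left mult.commute[of _ ?M])
  moreover have "0 < ?M"
    using pos by simp
  ultimately show ?thesis
    by (simp only: pos_le_divide_eq)
qed

theorem theorem3p6:
  fixes A B :: "complex ^ 'n ^ 'm" and r s :: nat and l u :: real
  assumes "rank A = r" and "r \<ge> 1" and "rank B = s" and "s \<ge> 1"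
    and "l \<in> {0..1}" and "u \<in> {0..1}"
  shows
    "(frob_norm (proj_col B - proj_col A))\<^sup>2
       + min (interp A l / interp B l) (interp B u / interp A u)
         * (frob_norm (proj_col (ctranspose B) - proj_col (ctranspose A)))\<^sup>2
     \<le> Phi A B l / interp B l + Psi A B u / interp A u
     \<and>
     (frob_norm (proj_col B - proj_col A))\<^sup>2
       + (frob_norm (proj_col (ctranspose B) - proj_col (ctranspose A)))\<^sup>2
     \<le> (Phi A B l + Psi A B u) / Min {interp A l, interp B l, interp A u, interp B u}
     \<and>
     (s = r \<longrightarrow>
       interp B l * (frob_norm (proj_col B - proj_col A))\<^sup>2
         + interp A l * (frob_norm (proj_col (ctranspose B) - proj_col (ctranspose A)))\<^sup>2
       \<le> 2 * Phi A B l
       \<and>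
       interp A u * (frob_norm (proj_col B - proj_col A))\<^sup>2
         + interp B u * (frob_norm (proj_col (ctranspose B) - proj_col (ctranspose A)))\<^sup>2
       \<le> 2 * Psi A B u)"
proof -
  \<comment> \<open>Every row of a zero matrix is zero, so its rank would be 0.\<close>
  have A: "A \<noteq> 0" and B: "B \<noteq> 0"
    using assms(1-4) by (auto simp: row_rank_def_gen rows_def row_def zero_vec_def[symmetric])
  note l = \<open>l \<in> {0..1}\<close> and u = \<open>u \<in> {0..1}\<close>
  let ?P = "A ** pinv A" and ?Q = "B ** pinv B" and ?R = "pinv A ** A" and ?S = "pinv B ** B"
  let ?a = "(norm ((mat 1 - ?P) ** ?Q))\<^sup>2" and ?b = "(norm ((mat 1 - ?S) ** ?R))\<^sup>2"
  let ?c = "(norm ((mat 1 - ?Q) ** ?P))\<^sup>2" and ?d = "(norm ((mat 1 - ?R) ** ?S))\<^sup>2"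
  have col: "(frob_norm (proj_col B - proj_col A))\<^sup>2 = ?a + ?c"
    unfolding frob_norm_eq_norm proj_col_def
    by (intro norm_sq_diff_orth_proj pinv_eqs)
  have row: "(frob_norm (proj_col (ctranspose B) - proj_col (ctranspose A)))\<^sup>2 = ?d + ?b"
    unfolding frob_norm_eq_norm proj_col_ctranspose
    by (intro norm_sq_diff_orth_proj pinv_eqs)
  note Phi = Phi_ge[OF A B l] and Psi = Phi_ge[OF B A u, folded Psi_eq_Phi]
  note pos = interp_pos[OF A l] interp_pos[OF B l] interp_pos[OF A u] interp_pos[OF B u]
  show ?thesis
    unfolding col row
  proof (intro conjI impI)
    assume "s = r"
    \<comment> \<open>Both squared differences are now twice one summand, so a single bound suffices
      for each inequality.\<close>
    then have "?a = ?c" "?b = ?d"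
      using norm_complement_proj_eq_if_rank_eq[of A B] assms(1,3) by simp_all
    then show "interp B l * (?a + ?c) + interp A l * (?d + ?b) \<le> 2 * Phi A B l"
      and "interp A u * (?a + ?c) + interp B u * (?d + ?b) \<le> 2 * Psi A B u"
      using Phi Psi by (simp_all add: algebra_simps)
  qed (intro weighted_bound uniform_bound Phi Psi pos zero_le_power2)+
qed

end
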